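(* Let $m,n\ge 3$ be integers with $(m,n)\neq(4,4)$. Then the direct product $C_m\times C_n$ of cycle graphs is Type 1, i.e. $\chi_T(C_m\times C_n)=\Delta(C_m\times C_n)+1=5$.
   Context: Graphs are finite and simple. For $n\ge 3$, $C_n$ denotes the cycle graph on $n$ vertices (the connected 2-regular graph). The direct product $G\times H$ of graphs $G$ and $H$ has vertex set $V(G)\times V(H)$, with $(u,v)$ and $(u',v')$ adjacent if and only if $uu'\in E(G)$ and $vv'\in E(H)$. A $k$-total coloring of a graph $G$ is an assignment of $k$ colors to its elements (vertices and edges) such that any two adjacent vertices, any two adjacent edges (distinct edges sharing an endpoint), and any edge and each of its endpoints receive distinct colors. The total chromatic number $\chi_T(G)$ is the smallest $k$ for which $G$ has a $k$-total coloring. $\Delta(G)$ denotes the maximum degree. $G$ is Type 1 if $\chi_T(G)=\Delta(G)+1$. *)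

theory Defs
  imports Main
begin

record 'a graph =
  verts :: "'a set"
  edges :: "'a set set"

definition fin_simple_graph :: "'a graph \<Rightarrow> bool" where
  "fin_simple_graph G \<longleftrightarrow>
     finite (verts G) \<and> (\<forall>e\<in>edges G. e \<subseteq> verts G \<and> card e = 2)"

definition degree :: "'a graph \<Rightarrow> 'a \<Rightarrow> nat" where
  "degree G v = card {e \<in> edges G. v \<in> e}"

definition max_degree :: "'a graph \<Rightarrow> nat" where
  "max_degree G = Max (degree G ` verts G)"

(* Meaningful for n \<ge> 3 only; smaller n give loops or a single edge. *)
definition cycle_graph :: "nat \<Rightarrow> nat graph" where
  "cycle_graph n = \<lparr>verts = {..<n}, edges = {{i, Suc i mod n} | i. i < n}\<rparr>"

definition direct_product :: "'a graph \<Rightarrow> 'b graph \<Rightarrow> ('a \<times> 'b) graph" where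
  "direct_product G H =
     \<lparr>verts = verts G \<times> verts H,
      edges = {{(u, v), (u', v')} | u v u' v'. {u, u'} \<in> edges G \<and> {v, v'} \<in> edges H}\<rparr>"

datatype 'a element = Vertex 'a | Edge "'a set"

definition elements :: "'a graph \<Rightarrow> 'a element set" where
  "elements G = Vertex ` verts G \<union> Edge ` edges G"

(* The k colors are the numbers below k; not all of them need be used. *)
definition total_coloring :: "'a graph \<Rightarrow> nat \<Rightarrow> ('a element \<Rightarrow> nat) \<Rightarrow> bool" where
  "total_coloring G k c \<longleftrightarrow>
     c ` elements G \<subseteq> {..<k} \<and>
     (\<forall>u v. {u, v} \<in> edges G \<longrightarrow> c (Vertex u) \<noteq> c (Vertex v)) \<and>
     (\<forall>e\<in>edges G. \<forall>f\<in>edges G. e \<noteq> f \<and> e \<inter> f \<noteq> {} \<longrightarrow> c (Edge e) \<noteq> c (Edge f)) \<and>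
     (\<forall>e\<in>edges G. \<forall>v\<in>e. c (Edge e) \<noteq> c (Vertex v))"

definition total_chromatic_number :: "'a graph \<Rightarrow> nat" where
  "total_chromatic_number G = (LEAST k. \<exists>c. total_coloring G k c)"

definition type1 :: "'a graph \<Rightarrow> bool" where
  "type1 G \<longleftrightarrow> total_chromatic_number G = max_degree G + 1"

lemma fin_simple_graph_cycle:
  assumes "n \<ge> 3"
  shows "fin_simple_graph (cycle_graph n)"
  using assms by (auto simp: fin_simple_graph_def cycle_graph_def card_insert_if mod_Suc)

lemma fin_simple_graph_direct_product:
  assumes "fin_simple_graph G" "fin_simple_graph H"
  shows "fin_simple_graph (direct_product G H)"
proof -
  have "card {(u, v), (u', v')} = 2" if "{u, u'} \<in> edges G" for u v u' v'
  proof -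
    have "u \<noteq> u'"
      using assms(1) that by (fastforce simp: fin_simple_graph_def)
    then show ?thesis by simp
  qed
  then show ?thesis
    using assms unfolding fin_simple_graph_def direct_product_def by auto
qed

lemma degree_cycle:
  assumes "n \<ge> 3" "v < n"
  shows "degree (cycle_graph n) v = 2"
proof -
  define w where "w = (if v = 0 then n - 1 else v - 1)"
  have w: "w < n" "Suc w mod n = v"
    using assms by (auto simp: w_def)
  have "w \<noteq> Suc v mod n"
    using assms by (auto simp: w_def mod_Suc)
  then have ne: "{v, Suc v mod n} \<noteq> {w, v}"
    using assms by (auto simp: doubleton_eq_iff mod_Suc)
  have "i = v \<or> i = w" if "i < n" "v \<in> {i, Suc i mod n}" for i
    using that by (auto simp: w_def mod_Suc split: if_splits)
  then have "{e \<in> edges (cycle_graph n). v \<in> e} = {{v, Suc v mod n}, {w, v}}"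
    using assms w unfolding cycle_graph_def by auto
  with ne show ?thesis by (simp add: degree_def)
qed

lemma connected_cycle:
  assumes "v < n"
  shows "(0, v) \<in> {(x, y). {x, y} \<in> edges (cycle_graph n)}\<^sup>*"
  using assms
proof (induction v)
  case (Suc v)
  then have "{v, Suc v} \<in> edges (cycle_graph n)"
    by (auto simp: cycle_graph_def intro!: exI[of _ v])
  with Suc show ?case by (auto intro: rtrancl_into_rtrancl)
qed simp

lemma ex_total_coloring:
  assumes "fin_simple_graph G"
  shows "\<exists>k c. total_coloring G k c"
proof -
  have "finite (verts G)" "edges G \<subseteq> Pow (verts G)"
    using assms by (auto simp: fin_simple_graph_def)
  then have "finite (elements G)"
    by (auto simp: elements_def intro: finite_subset)
  then obtain c :: "'a element \<Rightarrow> nat" and k where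
    c: "c ` elements G = {i. i < k}" "inj_on c (elements G)"
    using finite_imp_inj_to_nat_seg by metis
  have E: "Edge e \<in> elements G" if "e \<in> edges G" for e
    using that by (simp add: elements_def)
  have V: "Vertex v \<in> elements G" if "e \<in> edges G" "v \<in> e" for e v
    using that assms by (auto simp: elements_def fin_simple_graph_def)
  have "u \<noteq> v" if "{u, v} \<in> edges G" for u v
    using that assms by (fastforce simp: fin_simple_graph_def)
  then have "total_coloring G k c"
    unfolding total_coloring_def using c E V
    by (auto simp: inj_on_eq_iff[OF c(2)])
  then show ?thesis by blast
qed

end

theory Submission imports Defs begin

text \<open>
  A vertex of the product has degree 4, so together with its four edges it needs five colors. For
  the upper bound, take two finite digraphs and let the colors of the vertex (i, j), of the edge
  from (i, j) to (i + 1, j + 1) and of the edge from (i, j + 1) to (i + 1, j) depend only on the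
  pair of states reached after i and j steps of closed walks of lengths m and n. Whether this is
  a total coloring is a condition on pairs of single steps of the two digraphs, so one finite table
  serves all m and n for which closed walks exist. The left digraph has closed walks of all lengths
  at least 3, the right one of all these lengths except 4 (a common length 4 would color the
  product of two 4-cycles); the case n = 4 is handled by exchanging the factors.
\<close>

text \<open>
  The tables, indexed by left and right state, were found with a SAT solver.
\<close>

definition vertex_table :: "nat list list" where
  "vertex_table =
   [[2,0,4,3,4,0,1,3,0,4,1],
    [2,0,4,1,4,0,3,1,0,4,3],
    [2,0,1,1,1,2,3,1,2,2,3],
    [4,0,4,3,3,4,4,3,3,1,4],
    [1,0,1,0,2,0,1,4,2,2,0],
    [2,0,3,0,4,0,3,1,1,3,0],
    [1,3,4,3,4,4,4,4,4,3,3],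
    [0,0,0,0,0,0,0,0,0,1,1],
    [2,2,2,2,2,2,2,2,2,2,2]]"

definition diagonal_table :: "nat list list" where
  "diagonal_table =
   [[4,3,3,2,3,4,3,1,1,0,4],
    [1,1,1,2,1,2,1,4,2,0,2],
    [1,1,2,2,0,1,2,0,4,0,1],
    [1,3,3,0,1,2,3,1,1,3,2],
    [4,4,4,2,4,4,4,3,4,4,4],
    [1,1,1,2,1,2,1,4,2,0,2],
    [3,4,1,4,1,1,3,1,0,4,1],
    [4,1,3,1,3,3,3,3,3,3,3],
    [1,3,4,3,3,1,4,3,1,4,1]]"

definition antidiagonal_table :: "nat list list" where
  "antidiagonal_table =
   [[4,2,0,0,3,4,0,3,3,3,4],
    [3,2,0,0,1,2,0,4,2,1,2],
    [3,4,0,4,0,1,0,0,4,2,1],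
    [2,2,0,4,3,2,0,2,0,3,2],
    [3,2,0,1,3,3,0,3,0,1,3],
    [3,2,0,0,1,2,0,4,2,1,2],
    [2,2,2,2,2,2,2,2,2,2,2],
    [4,1,3,1,4,4,1,4,4,0,4],
    [0,0,0,0,0,0,0,0,1,0,0]]"

text \<open>
  Left: cycles of lengths 2 and 5 through 0, and a separate triangle on 6, 7, 8.
  Right: cycles of lengths 3, 5 and 7 through 0, the last one being 0, 3, 7, 8, 9, 10, 6.
\<close>

definition left_steps :: "(nat \<times> nat) list" where
  "left_steps = [(0,1), (1,0), (0,2), (2,3), (3,4), (4,5), (5,0), (6,7), (7,8), (8,6)]"

definition right_steps :: "(nat \<times> nat) list" where
  "right_steps = [(0,1), (1,2), (2,0), (0,3), (3,4), (4,5), (5,6), (6,0),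
                  (3,7), (7,8), (8,9), (9,10), (10,6)]"

text \<open>
  For steps from a to b and from c to d, the five elements listed are the vertex in state (b, d)
  and its incident edges; the last two inequalities are for the ends of the two edges joining
  the four vertices.
\<close>

definition compatible_tables ::
  "('s \<times> 's) set \<Rightarrow> ('t \<times> 't) set \<Rightarrow> nat \<Rightarrow>
    ('s \<Rightarrow> 't \<Rightarrow> nat) \<Rightarrow> ('s \<Rightarrow> 't \<Rightarrow> nat) \<Rightarrow> ('s \<Rightarrow> 't \<Rightarrow> nat) \<Rightarrow> bool" where
  "compatible_tables R R' k V D A \<longleftrightarrow>
     (\<forall>(a, b)\<in>R. \<forall>(c, d)\<in>R'.
        V b d < k \<and> D b d < k \<and> A b c < k \<and>
        distinct [V b d, D b d, D a c, A b c, A a d] \<and>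
        V a c \<noteq> V b d \<and> V a d \<noteq> V b c)"

text \<open>This is the finite check behind the coloring: evaluation settles all 10 * 13 pairs of a
  left and a right step. The individual table entries matter only here.\<close>

lemma compatible_steps:
  "compatible_tables (set left_steps) (set right_steps) 5
     (\<lambda>s t. vertex_table ! s ! t) (\<lambda>s t. diagonal_table ! s ! t)
     (\<lambda>s t. antidiagonal_table ! s ! t)"
  unfolding compatible_tables_def by code_simp

section \<open>Lengths of closed walks in the two digraphs\<close>

lemma relpow_mult_refl:
  assumes "(s, s) \<in> R ^^ k"
  shows "(s, s) \<in> R ^^ (k * q)"
proof (induction q)
  case (Suc q)
  then show ?case using assms by (auto simp: relpow_add)
qed simp

text \<open>Repeating the 2-cycle gives the even lengths, and putting the 5-cycle in front gives the
  odd ones from 5 on. The base point depends on \<open>m\<close> because length 3 occurs only in the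
  separate triangle.\<close>

lemma left_closed_walk:
  assumes "m \<ge> 3"
  shows "\<exists>s. (s, s) \<in> set left_steps ^^ m"
proof -
  have 2: "(0, 0) \<in> set left_steps ^^ 2"
    unfolding relpow_fun_conv by (rule exI[of _ "(!) [0,1,0]"]) code_simp
  have 5: "(0, 0) \<in> set left_steps ^^ 5"
    unfolding relpow_fun_conv by (rule exI[of _ "(!) [0,2,3,4,5,0]"]) code_simp
  have 3: "(6, 6) \<in> set left_steps ^^ 3"
    unfolding relpow_fun_conv by (rule exI[of _ "(!) [6,7,8,6]"]) code_simp
  consider q where "m = 2 * q" | "m = 3" | q where "m = 5 + 2 * q"
    using assms by atomize_elim presburger
  then show ?thesis
  proof cases
    case (1 q)
    with relpow_mult_refl[OF 2] show ?thesis by blast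
  next
    case 2
    with 3 show ?thesis by blast
  next
    case (3 q)
    with 5 relpow_mult_refl[OF 2, of q] show ?thesis
      by (auto simp: relpow_add)
  qed
qed

text \<open>The cycles of lengths 3, 5 and 7 represent the three residues modulo 3, and further
  triangles fill up each class. The only length from 3 on that is missed is 4.\<close>

lemma right_closed_walk:
  assumes "n \<ge> 3" "n \<noteq> 4"
  shows "(0, 0) \<in> set right_steps ^^ n"
proof -
  have 3: "(0, 0) \<in> set right_steps ^^ 3"
    unfolding relpow_fun_conv by (rule exI[of _ "(!) [0,1,2,0]"]) code_simp
  have 5: "(0, 0) \<in> set right_steps ^^ 5"
    unfolding relpow_fun_conv by (rule exI[of _ "(!) [0,3,4,5,6,0]"]) code_simp
  have 7: "(0, 0) \<in> set right_steps ^^ 7"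
    unfolding relpow_fun_conv by (rule exI[of _ "(!) [0,3,7,8,9,10,6,0]"]) code_simp
  consider q where "n = 3 * q" | q where "n = 5 + 3 * q" | q where "n = 7 + 3 * q"
    using assms by atomize_elim presburger
  then show ?thesis
    using relpow_mult_refl[OF 3] 5 7 by cases (auto simp: relpow_add)
qed

lemma relpow_closed_walk:
  assumes "(s, s) \<in> R ^^ m"
  obtains w where "\<And>i. i < m \<Longrightarrow> (w i, w (Suc i mod m)) \<in> R"
proof -
  obtain w where w: "w 0 = s" "w m = s" "\<forall>i<m. (w i, w (Suc i)) \<in> R"
    using assms by (auto simp: relpow_fun_conv)
  have "(w i, w (Suc i mod m)) \<in> R" if "i < m" for i
    using w that by (cases "Suc i = m") auto
  then show thesis by (rule that)
qed

section \<open>Edges and degrees of the product of two cycles\<close>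

text \<open>Drawn on a torus, each unit square contains two edges of the product, one along each
  diagonal. Both are indexed by the corner \<open>(i, j)\<close> of the square, although the
  antidiagonal one does not pass through it for lengths at least 3.\<close>

definition diagonal_edge :: "nat \<Rightarrow> nat \<Rightarrow> nat \<times> nat \<Rightarrow> (nat \<times> nat) set" where
  "diagonal_edge m n = (\<lambda>(i, j). {(i, j), (Suc i mod m, Suc j mod n)})"

definition antidiagonal_edge :: "nat \<Rightarrow> nat \<Rightarrow> nat \<times> nat \<Rightarrow> (nat \<times> nat) set" where
  "antidiagonal_edge m n = (\<lambda>(i, j). {(i, Suc j mod n), (Suc i mod m, j)})"

lemma verts_product_cycles:
  "verts (direct_product (cycle_graph m) (cycle_graph n)) = {..<m} \<times> {..<n}"
  by (simp add: direct_product_def cycle_graph_def)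

lemma edges_product_cycles:
  "edges (direct_product (cycle_graph m) (cycle_graph n)) =
   diagonal_edge m n ` ({..<m} \<times> {..<n}) \<union> antidiagonal_edge m n ` ({..<m} \<times> {..<n})"
  (is "?E = ?F")
proof
  show "?E \<subseteq> ?F"
  proof
    fix e assume "e \<in> ?E"
    then obtain u v u' v' i j where e: "e = {(u, v), (u', v')}"
      and i: "i < m" "{u, u'} = {i, Suc i mod m}" and j: "j < n" "{v, v'} = {j, Suc j mod n}"
      by (auto simp: direct_product_def cycle_graph_def)
    \<comment> \<open>The edge is diagonal if both coordinates run through their cycle edges in the
      same direction, antidiagonal otherwise.\<close>
    then have "e = diagonal_edge m n (i, j) \<or> e = antidiagonal_edge m n (i, j)"
      by (auto simp: diagonal_edge_def antidiagonal_edge_def doubleton_eq_iff)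
    with i j show "e \<in> ?F" by blast
  qed
  have "\<exists>u v u' v'. diagonal_edge m n (i, j) = {(u, v), (u', v')} \<and>
      {u, u'} \<in> edges (cycle_graph m) \<and> {v, v'} \<in> edges (cycle_graph n)"
    "\<exists>u v u' v'. antidiagonal_edge m n (i, j) = {(u, v), (u', v')} \<and>
      {u, u'} \<in> edges (cycle_graph m) \<and> {v, v'} \<in> edges (cycle_graph n)"
    if "i < m" "j < n" for i j
  proof -
    have *: "{i, Suc i mod m} \<in> edges (cycle_graph m)" "{j, Suc j mod n} \<in> edges (cycle_graph n)"
      "{Suc j mod n, j} \<in> edges (cycle_graph n)"
      using that by (auto simp: cycle_graph_def insert_commute)
    show "\<exists>u v u' v'. diagonal_edge m n (i, j) = {(u, v), (u', v')} \<and>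
        {u, u'} \<in> edges (cycle_graph m) \<and> {v, v'} \<in> edges (cycle_graph n)"
      using * unfolding diagonal_edge_def by blast
    show "\<exists>u v u' v'. antidiagonal_edge m n (i, j) = {(u, v), (u', v')} \<and>
        {u, u'} \<in> edges (cycle_graph m) \<and> {v, v'} \<in> edges (cycle_graph n)"
      using * unfolding antidiagonal_edge_def by blast
  qed
  then show "?F \<subseteq> ?E"
    unfolding direct_product_def by auto
qed

lemma Suc_mod_neq:
  assumes "n \<ge> 3" "i < n"
  shows "Suc i mod n \<noteq> i" "Suc (Suc i mod n) mod n \<noteq> i"
  using assms by (auto simp: mod_Suc split: if_splits)

lemma Suc_mod_inject:
  assumes "i < n" "j < n"
  shows "Suc i mod n = Suc j mod n \<longleftrightarrow> i = j"
  using assms by (auto simp: mod_Suc split: if_splits)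

lemma Suc_mod_surj:
  assumes "i < (n :: nat)"
  obtains j where "j < n" "i = Suc j mod n"
proof
  show "(if i = 0 then n - 1 else i - 1) < n" "i = Suc (if i = 0 then n - 1 else i - 1) mod n"
    using assms by auto
qed

lemma predecessor_in_grid:
  fixes m n :: nat
  assumes "v \<in> {..<m} \<times> {..<n}"
  obtains i j where "v = (Suc i mod m, Suc j mod n)" "i < m" "j < n"
proof -
  obtain k l where v: "v = (k, l)" "k < m" "l < n" using assms by auto
  obtain i where "i < m" "k = Suc i mod m" using v(2) by (rule Suc_mod_surj)
  moreover obtain j where "j < n" "l = Suc j mod n" using v(3) by (rule Suc_mod_surj)
  ultimately show thesis using that v(1) by blast
qed

text \<open>If two indices gave the same edge with its ends exchanged, the first coordinate would
  return after two steps, which length at least 3 forbids.\<close>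

lemma inj_on_diagonal_edge:
  assumes "m \<ge> 3"
  shows "inj_on (diagonal_edge m n) ({..<m} \<times> {..<n})"
  using assms by (auto simp: inj_on_def diagonal_edge_def doubleton_eq_iff Suc_mod_neq
      Suc_mod_neq[symmetric])

lemma inj_on_antidiagonal_edge:
  assumes "m \<ge> 3"
  shows "inj_on (antidiagonal_edge m n) ({..<m} \<times> {..<n})"
  using assms
  by (auto simp: inj_on_def antidiagonal_edge_def doubleton_eq_iff Suc_mod_neq Suc_mod_neq[symmetric]
      Suc_mod_inject)

text \<open>Matching the ends in order makes the second coordinate return after two steps; matching
  them crosswise does the same to the first.\<close>

lemma diagonal_neq_antidiagonal:
  assumes "m \<ge> 3" "n \<ge> 3" "p \<in> {..<m} \<times> {..<n}" "q \<in> {..<m} \<times> {..<n}"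
  shows "diagonal_edge m n p \<noteq> antidiagonal_edge m n q"
  using assms
  by (auto simp: diagonal_edge_def antidiagonal_edge_def doubleton_eq_iff Suc_mod_neq
      Suc_mod_neq[symmetric])

text \<open>Each of the four squares around a vertex contributes one edge. Writing the vertex as a
  successor in both coordinates avoids subtraction modulo \<open>m\<close> and
  \<open>n\<close>.\<close>

lemma incident_edges_product_cycles:
  assumes "m \<ge> 3" "n \<ge> 3" "i < m" "j < n"
  defines "i' \<equiv> Suc i mod m" and "j' \<equiv> Suc j mod n"
  shows "{e \<in> edges (direct_product (cycle_graph m) (cycle_graph n)). (i', j') \<in> e} =
    {diagonal_edge m n (i', j'), diagonal_edge m n (i, j),
     antidiagonal_edge m n (i', j), antidiagonal_edge m n (i, j')}"
proof -
  have ij': "i' < m" "j' < n" using assms by auto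
  have D: "(i', j') \<in> diagonal_edge m n p \<longleftrightarrow> p = (i, j) \<or> p = (i', j')"
    and A: "(i', j') \<in> antidiagonal_edge m n p \<longleftrightarrow> p = (i', j) \<or> p = (i, j')"
    if "p \<in> {..<m} \<times> {..<n}" for p
    using that assms(3,4) unfolding i'_def j'_def
    by (auto simp: diagonal_edge_def antidiagonal_edge_def Suc_mod_inject)
  show ?thesis
    unfolding edges_product_cycles using assms(3,4) ij' D A by blast
qed

lemma degree_product_cycles:
  assumes "m \<ge> 3" "n \<ge> 3" "v \<in> {..<m} \<times> {..<n}"
  shows "degree (direct_product (cycle_graph m) (cycle_graph n)) v = 4"
proof -
  obtain i j where v: "v = (Suc i mod m, Suc j mod n)" and ij: "i < m" "j < n"
    using assms(3) by (rule predecessor_in_grid)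
  have ij': "Suc i mod m < m" "Suc j mod n < n" using assms by auto
  \<comment> \<open>The two diagonal edges differ in their first index, and so do the two
    antidiagonal ones.\<close>
  have "Suc i mod m \<noteq> i" using Suc_mod_neq assms ij by blast
  then show ?thesis
    unfolding degree_def v incident_edges_product_cycles[OF assms(1,2) ij]
    using ij ij' diagonal_neq_antidiagonal[OF assms(1,2)]
    by (auto simp: card_insert_if inj_on_eq_iff[OF inj_on_diagonal_edge[OF assms(1)]]
        inj_on_eq_iff[OF inj_on_antidiagonal_edge[OF assms(1)]])
qed

lemma max_degree_product_cycles:
  assumes "m \<ge> 3" "n \<ge> 3"
  shows "max_degree (direct_product (cycle_graph m) (cycle_graph n)) = 4"
proof -
  have "degree (direct_product (cycle_graph m) (cycle_graph n)) ` ({..<m} \<times> {..<n}) =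
      (\<lambda>_. 4) ` ({..<m} \<times> {..<n})"
    using degree_product_cycles[OF assms] by (intro image_cong) simp_all
  also have "\<dots> = {4}"
    using assms by (auto simp: image_constant_conv lessThan_empty_iff)
  finally show ?thesis by (simp add: max_degree_def verts_product_cycles)
qed

section \<open>Total colorings in general and the lower bound\<close>

lemma total_coloringD:
  assumes "total_coloring G k c"
  shows "c ` elements G \<subseteq> {..<k}"
    and "\<And>u v. {u, v} \<in> edges G \<Longrightarrow> c (Vertex u) \<noteq> c (Vertex v)"
    and "\<And>e f. e \<in> edges G \<Longrightarrow> f \<in> edges G \<Longrightarrow> e \<noteq> f \<Longrightarrow> e \<inter> f \<noteq> {} \<Longrightarrow>
      c (Edge e) \<noteq> c (Edge f)"
    and "\<And>e v. e \<in> edges G \<Longrightarrow> v \<in> e \<Longrightarrow> c (Edge e) \<noteq> c (Vertex v)"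
  using assms unfolding total_coloring_def by simp_all

lemma total_coloringI:
  assumes "c ` elements G \<subseteq> {..<k}"
    and "\<And>u v. {u, v} \<in> edges G \<Longrightarrow> c (Vertex u) \<noteq> c (Vertex v)"
    and "\<And>e f. e \<in> edges G \<Longrightarrow> f \<in> edges G \<Longrightarrow> e \<noteq> f \<Longrightarrow> e \<inter> f \<noteq> {} \<Longrightarrow>
      c (Edge e) \<noteq> c (Edge f)"
    and "\<And>e v. e \<in> edges G \<Longrightarrow> v \<in> e \<Longrightarrow> c (Edge e) \<noteq> c (Vertex v)"
  shows "total_coloring G k c"
  unfolding total_coloring_def using assms by simp

text \<open>A vertex and its incident edges have pairwise distinct colors.\<close>

lemma degree_less_of_total_coloring:
  assumes "fin_simple_graph G" "total_coloring G k c" "v \<in> verts G"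
  shows "degree G v < k"
proof -
  let ?I = "{e \<in> edges G. v \<in> e}"
  have "edges G \<subseteq> Pow (verts G)" "finite (verts G)"
    using assms(1) by (auto simp: fin_simple_graph_def)
  then have fin: "finite ?I"
    by (auto intro: finite_subset[of _ "Pow (verts G)"])
  have inj: "inj_on (\<lambda>e. c (Edge e)) ?I"
    using assms(2) unfolding total_coloring_def inj_on_def by blast
  have "c (Vertex v) \<notin> (\<lambda>e. c (Edge e)) ` ?I"
    using assms(2) unfolding total_coloring_def by (auto dest: sym)
  then have "Suc (degree G v) = card (insert (c (Vertex v)) ((\<lambda>e. c (Edge e)) ` ?I))"
    using fin by (simp add: card_image[OF inj] degree_def)
  also have "\<dots> \<le> card {..<k}"
    using assms(2,3) by (intro card_mono) (auto simp: total_coloring_def elements_def)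
  finally show ?thesis by simp
qed

section \<open>Coloring the product along two closed walks\<close>

text \<open>Every possible conflict lies among a vertex and its four edges, or between the two ends
  of an edge. Either way the states involved come from one step of each walk, which is what
  \<open>compatible_tables\<close> controls.\<close>

lemma total_coloring_product_cycles:
  assumes "m \<ge> 3" "n \<ge> 3"
    and tables: "compatible_tables R R' k V D A"
    and "(s, s) \<in> R ^^ m" "(t, t) \<in> R' ^^ n"
  shows "\<exists>c. total_coloring (direct_product (cycle_graph m) (cycle_graph n)) k c"
proof -
  let ?G = "direct_product (cycle_graph m) (cycle_graph n)"
  let ?P = "{..<m} \<times> {..<n}"
  obtain w where w: "\<And>i. i < m \<Longrightarrow> (w i, w (Suc i mod m)) \<in> R"
    using relpow_closed_walk[OF assms(4)] by blast
  obtain x where x: "\<And>j. j < n \<Longrightarrow> (x j, x (Suc j mod n)) \<in> R'"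
    using relpow_closed_walk[OF assms(5)] by blast
  define col where "col f = (\<lambda>(i, j). f (w i) (x j))" for f :: "'a \<Rightarrow> 'b \<Rightarrow> nat"
  \<comment> \<open>An edge is only a set, so its index is recovered by \<open>inv_into\<close>.
    Edges outside the diagonal family are read as antidiagonal, which is sound because the families
    are disjoint.\<close>
  define c where "c = (\<lambda>Vertex v \<Rightarrow> col V v
    | Edge e \<Rightarrow> if e \<in> diagonal_edge m n ` ?P then col D (inv_into ?P (diagonal_edge m n) e)
               else col A (inv_into ?P (antidiagonal_edge m n) e))"
  have cV: "c (Vertex (i, j)) = V (w i) (x j)" for i j
    by (simp add: c_def col_def)
  have cD: "c (Edge (diagonal_edge m n (i, j))) = D (w i) (x j)" if "i < m" "j < n" for i j
    using that by (simp add: c_def col_def inv_into_f_f[OF inj_on_diagonal_edge[OF assms(1)]])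
  have cA: "c (Edge (antidiagonal_edge m n (i, j))) = A (w i) (x j)" if "i < m" "j < n" for i j
  proof -
    have "antidiagonal_edge m n (i, j) \<notin> diagonal_edge m n ` ?P"
      using diagonal_neq_antidiagonal[OF assms(1,2), of _ "(i, j)"] that by fastforce
    then show ?thesis
      using that by (simp add: c_def col_def inv_into_f_f[OF inj_on_antidiagonal_edge[OF assms(1)]])
  qed
  have colors: "V b d < k \<and> D b d < k \<and> A b c < k \<and>
      distinct [V b d, D b d, D a c, A b c, A a d] \<and> V a c \<noteq> V b d \<and> V a d \<noteq> V b c"
    if "(a, b) \<in> R" "(c, d) \<in> R'" for a b c d
    using tables that unfolding compatible_tables_def by fast
  have e_vert: "v \<in> ?P" if "e \<in> edges ?G" "v \<in> e" for e v
    using that assms(1,2)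
    by (auto simp: edges_product_cycles diagonal_edge_def antidiagonal_edge_def)
  \<comment> \<open>Meeting edges share a vertex, so edge-edge and edge-vertex conflicts can be
    excluded together at one vertex.\<close>
  have at_vertex: "c (Edge e) \<noteq> c (Vertex v) \<and>
      (\<forall>f. f \<in> edges ?G \<and> v \<in> f \<and> e \<noteq> f \<longrightarrow> c (Edge e) \<noteq> c (Edge f))"
    if e: "e \<in> edges ?G" "v \<in> e" for e v
  proof -
    obtain i j where v: "v = (Suc i mod m, Suc j mod n)" and ij: "i < m" "j < n"
      using e_vert[OF e] by (rule predecessor_in_grid)
    have ij': "Suc i mod m < m" "Suc j mod n < n" using assms(1,2) by auto
    \<comment> \<open>The order is that of the list in \<open>compatible_tables\<close>, so its
      \<open>distinct\<close> condition applies directly.\<close>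
    define es where "es = [diagonal_edge m n (Suc i mod m, Suc j mod n), diagonal_edge m n (i, j),
      antidiagonal_edge m n (Suc i mod m, j), antidiagonal_edge m n (i, Suc j mod n)]"
    have es: "f \<in> set es" if "f \<in> edges ?G" "v \<in> f" for f
    proof -
      have "f \<in> {e \<in> edges ?G. (Suc i mod m, Suc j mod n) \<in> e}"
        using that v by simp
      then show ?thesis
        unfolding incident_edges_product_cycles[OF assms(1,2) ij] es_def by simp
    qed
    have "distinct (c (Vertex v) # map (\<lambda>e. c (Edge e)) es)"
      using colors[OF w[OF ij(1)] x[OF ij(2)]] ij ij' by (simp add: es_def v cV cD cA)
    then have notin: "c (Vertex v) \<notin> (\<lambda>e. c (Edge e)) ` set es"
      and inj: "inj_on (\<lambda>e. c (Edge e)) (set es)"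
      by (simp_all only: distinct.simps set_map distinct_map simp_thms)
    show ?thesis
    proof (intro conjI allI impI)
      show "c (Edge e) \<noteq> c (Vertex v)"
        using notin es[OF e] by (metis imageI)
    next
      fix f assume "f \<in> edges ?G \<and> v \<in> f \<and> e \<noteq> f"
      then show "c (Edge e) \<noteq> c (Edge f)"
        using inj_onD[OF inj _ es[OF e] es[of f]] by metis
    qed
  qed
  have "c (Vertex v) < k" if v: "v \<in> ?P" for v
  proof -
    obtain i j where ij: "v = (Suc i mod m, Suc j mod n)" "i < m" "j < n"
      using v by (rule predecessor_in_grid)
    show ?thesis
      using colors[OF w[OF ij(2)] x[OF ij(3)]] by (simp add: ij(1) cV)
  qed
  moreover have "c (Edge e) < k" if e: "e \<in> edges ?G" for e
  proof -
    obtain p where p: "p \<in> ?P" and ep: "e = diagonal_edge m n p \<or> e = antidiagonal_edge m n p"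
      using e by (auto simp: edges_product_cycles)
    obtain i j where ij: "p = (Suc i mod m, Suc j mod n)" "i < m" "j < n"
      using p by (rule predecessor_in_grid)
    have ij': "Suc i mod m < m" "Suc j mod n < n" using assms(1,2) by auto
    have "D (w (Suc i mod m)) (x (Suc j mod n)) < k"
      using colors[OF w[OF ij(2)] x[OF ij(3)]] by blast
    \<comment> \<open>The table condition bounds \<open>A b c\<close> with \<open>c\<close> the
      start of the right step, so here that step must start at \<open>Suc j mod n\<close>.\<close>
    moreover have "A (w (Suc i mod m)) (x (Suc j mod n)) < k"
      using colors[OF w[OF ij(2)] x[OF ij'(2)]] by blast
    ultimately show ?thesis
      using ep cD[OF ij'] cA[OF ij'] by (auto simp: ij(1))
  qed
  ultimately have "c ` elements ?G \<subseteq> {..<k}"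
    by (auto simp: elements_def verts_product_cycles)
  moreover have "c (Vertex u) \<noteq> c (Vertex v)" if uv: "{u, v} \<in> edges ?G" for u v
  proof -
    obtain i j where ij: "i < m" "j < n"
      and e: "{u, v} = diagonal_edge m n (i, j) \<or> {u, v} = antidiagonal_edge m n (i, j)"
      using uv by (auto simp: edges_product_cycles)
    have "V (w i) (x j) \<noteq> V (w (Suc i mod m)) (x (Suc j mod n))"
      "V (w i) (x (Suc j mod n)) \<noteq> V (w (Suc i mod m)) (x j)"
      using colors[OF w[OF ij(1)] x[OF ij(2)]] by blast+
    with e show ?thesis
      unfolding diagonal_edge_def antidiagonal_edge_def prod.case doubleton_eq_iff
      by (elim disjE conjE) (simp_all add: cV)
  qed
  moreover have "c (Edge e) \<noteq> c (Edge f)"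
    if ef: "e \<in> edges ?G" "f \<in> edges ?G" "e \<noteq> f" "e \<inter> f \<noteq> {}" for e f
  proof -
    obtain v where v: "v \<in> e" "v \<in> f" using ef(4) by blast
    show ?thesis
      using conjunct2[OF at_vertex[OF ef(1) v(1)]] ef(2,3) v(2) by simp
  qed
  moreover have "c (Edge e) \<noteq> c (Vertex v)" if "e \<in> edges ?G" "v \<in> e" for e v
    using conjunct1[OF at_vertex[OF that]] .
  ultimately have "total_coloring ?G k c"
    by (rule total_coloringI)
  then show ?thesis by blast
qed

section \<open>Exchanging the factors, and the conclusion\<close>

text \<open>The coloring is pulled back along the isomorphism \<open>prod.swap\<close>. This serves
  the case of a right factor of length 4.\<close>

lemma total_coloring_direct_product_swap:
  assumes "total_coloring (direct_product G H) k c"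
  shows "\<exists>c. total_coloring (direct_product H G) k c"
proof -
  have E: "prod.swap ` e \<in> edges (direct_product G H)" if e: "e \<in> edges (direct_product H G)" for e
  proof -
    obtain u v u' v' where "e = {(u, v), (u', v')}" "{u, u'} \<in> edges H" "{v, v'} \<in> edges G"
      using e by (auto simp: direct_product_def)
    moreover have "prod.swap ` {(u, v), (u', v')} = {(v, u), (v', u')}" by simp
    ultimately show ?thesis
      unfolding direct_product_def by simp blast
  qed
  have V: "prod.swap v \<in> verts (direct_product G H)" if "v \<in> verts (direct_product H G)" for v
    using that by (auto simp: direct_product_def)
  note c = total_coloringD[OF assms]
  define c' where "c' = (\<lambda>Vertex v \<Rightarrow> c (Vertex (prod.swap v)) | Edge e \<Rightarrow> c (Edge (prod.swap ` e)))"
  have c'_Vertex: "c' (Vertex v) = c (Vertex (prod.swap v))" for v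
    by (simp add: c'_def)
  have c'_Edge: "c' (Edge e) = c (Edge (prod.swap ` e))" for e
    by (simp add: c'_def)
  have "c' ` elements (direct_product H G) \<subseteq> {..<k}"
  proof (intro image_subsetI)
    fix z assume "z \<in> elements (direct_product H G)"
    then consider v where "z = Vertex v" "v \<in> verts (direct_product H G)"
      | e where "z = Edge e" "e \<in> edges (direct_product H G)"
      unfolding elements_def by blast
    then have "c' z \<in> c ` elements (direct_product G H)"
    proof cases
      case (1 v)
      then show ?thesis using V unfolding elements_def by (simp add: c'_Vertex)
    next
      case (2 e)
      then show ?thesis using E unfolding elements_def by (simp add: c'_Edge)
    qed
    then show "c' z \<in> {..<k}" using c(1) by (rule subsetD[rotated])
  qed
  moreover have "c' (Vertex u) \<noteq> c' (Vertex v)" if "{u, v} \<in> edges (direct_product H G)" for u v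
  proof -
    have "{prod.swap u, prod.swap v} \<in> edges (direct_product G H)"
      using E[OF that] by simp
    then show ?thesis unfolding c'_Vertex by (rule c(2))
  qed
  moreover have "c' (Edge e) \<noteq> c' (Edge f)"
    if "e \<in> edges (direct_product H G)" "f \<in> edges (direct_product H G)" "e \<noteq> f" "e \<inter> f \<noteq> {}"
    for e f
  proof -
    have "prod.swap ` e \<noteq> prod.swap ` f"
      using that(3) by (simp add: inj_image_eq_iff)
    moreover have "prod.swap ` e \<inter> prod.swap ` f \<noteq> {}"
      using that(4) by blast
    ultimately show ?thesis
      unfolding c'_Edge by (rule c(3)[OF E[OF that(1)] E[OF that(2)]])
  qed
  moreover have "c' (Edge e) \<noteq> c' (Vertex v)" if "e \<in> edges (direct_product H G)" "v \<in> e" for e v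
  proof -
    have "prod.swap v \<in> prod.swap ` e" using that(2) by (rule imageI)
    then show ?thesis unfolding c'_Edge c'_Vertex by (rule c(4)[OF E[OF that(1)]])
  qed
  ultimately have "total_coloring (direct_product H G) k c'"
    by (rule total_coloringI)
  then show ?thesis by blast
qed

theorem theorem1:
  fixes m n :: nat
  assumes "m \<ge> 3" and "n \<ge> 3" and "(m, n) \<noteq> (4, 4)"
  shows "type1 (direct_product (cycle_graph m) (cycle_graph n)) \<and>
         total_chromatic_number (direct_product (cycle_graph m) (cycle_graph n)) = 5"
proof -
  let ?G = "direct_product (cycle_graph m) (cycle_graph n)"
  have coloring: "\<exists>c. total_coloring (direct_product (cycle_graph a) (cycle_graph b)) 5 c"
    if ab: "a \<ge> 3" "b \<ge> 3" "b \<noteq> 4" for a b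
  proof -
    obtain s where "(s, s) \<in> set left_steps ^^ a"
      using left_closed_walk[OF ab(1)] ..
    then show ?thesis
      using total_coloring_product_cycles[OF ab(1,2) compatible_steps]
        right_closed_walk[OF ab(2,3)] by blast
  qed
  have "\<exists>c. total_coloring ?G 5 c"
  proof (cases "n = 4")
    case True
    \<comment> \<open>Now \<open>m\<close> is not 4, so the cycle of length 4 can follow the left
      digraph and the other one the right digraph.\<close>
    with assms show ?thesis
      using coloring[of n m] total_coloring_direct_product_swap by blast
  qed (use coloring assms in blast)
  moreover have "5 \<le> k" if k: "\<exists>c. total_coloring ?G k c" for k
  proof -
    obtain c where c: "total_coloring ?G k c" using k ..
    have "fin_simple_graph ?G"
      using assms by (intro fin_simple_graph_direct_product fin_simple_graph_cycle)
    then have "degree ?G (0, 0) < k"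
      using assms by (intro degree_less_of_total_coloring[OF _ c]) (simp_all add: verts_product_cycles)
    then show ?thesis using degree_product_cycles[of m n "(0, 0)"] assms by simp
  qed
  ultimately have "total_chromatic_number ?G = 5"
    unfolding total_chromatic_number_def by (rule Least_equality)
  then show ?thesis
    by (simp add: type1_def max_degree_product_cycles assms)
qed

end
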